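(* Let $m,d,k\in\mathbb{N}$. Let $G$ be a finitely generated group, let $\Gamma$ be a subgroup of $G$ of index at most $m$, and let $H$ be a normal subgroup of $\Gamma$ of cardinality at most $d$ such that $\Gamma/H$ is $k$-step nilpotent. Let $M=(\mu_n)_{n=1}^\infty$ be a sequence of probability measures that measures index uniformly on $G$. Then $$\mathrm{dc}_M^k(G)\ge\frac{1}{m^{k+1}d}.$$
   Context: Groups are discrete. A group is $k$-step nilpotent if all $(k+1)$-fold simple commutators of its elements are trivial (nilpotent of class at most $k$), where $[x_1,x_2]=x_1^{-1}x_2^{-1}x_1x_2$ and $[x_1,\ldots,x_k]=[[x_1,\ldots,x_{k-1}],x_k]$. For a probability measure $\mu$ on $G$, $\mathrm{dc}^k_\mu(G)$ is the probability that $[x_1,\ldots,x_{k+1}]=1$ when $x_1,\ldots,x_{k+1}$ are chosen independently according to $\mu$. For a sequence $M=(\mu_n)_{n=1}^\infty$ of probability measures, $\mathrm{dc}_M^k(G)=\limsup_{n\to\infty}\mathrm{dc}^k_{\mu_n}(G)$. The sequence $M$ measures index uniformly if $\mu_n(xH)\to1/[G:H]$ as $n\to\infty$, uniformly over all $x\in G$ and all subgroups $H$ of $G$, where $1/[G:H]=0$ if $[G:H]=\infty$. *)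

theory Defs
  imports "HOL-Algebra.Algebra" "HOL-Probability.Probability"
begin

definition finitely_generated_group :: "('a, 'b) monoid_scheme \<Rightarrow> bool" where
  "finitely_generated_group G \<longleftrightarrow>
     group G \<and> (\<exists>S. finite S \<and> S \<subseteq> carrier G \<and> generate G S = carrier G)"

definition finite_index :: "('a, 'b) monoid_scheme \<Rightarrow> 'a set \<Rightarrow> bool" where
  "finite_index G H \<longleftrightarrow> finite (rcosets\<^bsub>G\<^esub> H)"

text \<open>The index is \<open>0\<close> (the cardinality of an infinite set) unless \<^const>\<open>finite_index\<close> holds.\<close>

definition group_index :: "('a, 'b) monoid_scheme \<Rightarrow> 'a set \<Rightarrow> nat" where
  "group_index G H = card (rcosets\<^bsub>G\<^esub> H)"

definition group_commutator :: "('a, 'b) monoid_scheme \<Rightarrow> 'a \<Rightarrow> 'a \<Rightarrow> 'a" where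
  "group_commutator G x y = inv\<^bsub>G\<^esub> x \<otimes>\<^bsub>G\<^esub> inv\<^bsub>G\<^esub> y \<otimes>\<^bsub>G\<^esub> x \<otimes>\<^bsub>G\<^esub> y"

text \<open>With entries numbered from \<open>0\<close>, \<open>simple_commutator G x k\<close> is the \<open>(k + 1)\<close>-fold
  left-normed commutator \<open>[x 0, \<dots>, x k]\<close>; the \<open>1\<close>-fold commutator is \<open>x 0\<close> itself.\<close>

primrec simple_commutator :: "('a, 'b) monoid_scheme \<Rightarrow> (nat \<Rightarrow> 'a) \<Rightarrow> nat \<Rightarrow> 'a" where
  "simple_commutator G x 0 = x 0"
| "simple_commutator G x (Suc k) = group_commutator G (simple_commutator G x k) (x (Suc k))"

definition step_nilpotent :: "nat \<Rightarrow> ('a, 'b) monoid_scheme \<Rightarrow> bool" where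
  "step_nilpotent k G \<longleftrightarrow>
     group G \<and> (\<forall>x \<in> {..k} \<rightarrow> carrier G. simple_commutator G x k = \<one>\<^bsub>G\<^esub>)"

text \<open>Groups are discrete, so every subset is measurable.\<close>

definition prob_measure_on :: "('a, 'b) monoid_scheme \<Rightarrow> 'a measure \<Rightarrow> bool" where
  "prob_measure_on G \<mu> \<longleftrightarrow> prob_space \<mu> \<and> space \<mu> = carrier G \<and> sets \<mu> = Pow (carrier G)"

text \<open>Independent choices \<open>x 0, \<dots>, x k\<close> according to \<open>\<mu>\<close> amount to a choice of \<open>x\<close>
  according to the product measure. The event is measurable whenever the group is countable
  (\<open>dc_event_measurable\<close> below), in particular whenever it is finitely generated.\<close>

definition dc :: "nat \<Rightarrow> ('a, 'b) monoid_scheme \<Rightarrow> 'a measure \<Rightarrow> real" where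
  "dc k G \<mu> = measure (\<Pi>\<^sub>M i\<in>{..k}. \<mu>)
     {x \<in> space (\<Pi>\<^sub>M i\<in>{..k}. \<mu>). simple_commutator G x k = \<one>\<^bsub>G\<^esub>}"

lemma dc_event_measurable:
  assumes "prob_measure_on G \<mu>" and "countable (carrier G)"
  shows "{x \<in> space (\<Pi>\<^sub>M i\<in>{..k}. \<mu>). simple_commutator G x k = \<one>\<^bsub>G\<^esub>} \<in> sets (\<Pi>\<^sub>M i\<in>{..k}. \<mu>)"
proof -
  have "sets (\<Pi>\<^sub>M i\<in>{..k}. \<mu>) = sets (\<Pi>\<^sub>M i\<in>{..k}. count_space (carrier G))"
    using assms(1) by (intro sets_PiM_cong) (auto simp: prob_measure_on_def)
  also have "\<dots> = sets (count_space ({..k} \<rightarrow>\<^sub>E carrier G))"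
    using assms(2) by (subst count_space_PiM_finite) auto
  finally show ?thesis
    using assms(1) by (auto simp: space_PiM prob_measure_on_def)
qed

definition dc_limsup :: "nat \<Rightarrow> ('a, 'b) monoid_scheme \<Rightarrow> (nat \<Rightarrow> 'a measure) \<Rightarrow> ereal" where
  "dc_limsup k G M = limsup (\<lambda>n. ereal (dc k G (M n)))"

definition measures_index_uniformly ::
    "('a, 'b) monoid_scheme \<Rightarrow> (nat \<Rightarrow> 'a measure) \<Rightarrow> bool" where
  "measures_index_uniformly G M \<longleftrightarrow>
     uniform_limit {(x, H). x \<in> carrier G \<and> subgroup H G}
       (\<lambda>n (x, H). measure (M n) (x <#\<^bsub>G\<^esub> H))
       (\<lambda>(x, H). if finite_index G H then 1 / real (group_index G H) else 0)
       sequentially"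

end

theory Submission
  imports Defs
begin

text \<open>Fix \<open>x\<^sub>1, \<dots>, x\<^sub>k \<in> \<Gamma>\<close> and put \<open>c = [x\<^sub>1, \<dots>, x\<^sub>k]\<close>. Since \<open>\<Gamma>/H\<close> is \<open>k\<close>-step nilpotent,
  \<open>[c, y] \<in> H\<close> for all \<open>y \<in> \<Gamma>\<close>, so the \<open>\<Gamma>\<close>-conjugates of \<open>c\<close> lie in \<open>c H\<close>. There are at most \<open>d\<close>
  of them, so the centraliser of \<open>c\<close> in \<open>\<Gamma>\<close> has index at most \<open>m d\<close> in \<open>G\<close>. By uniformity a random
  \<open>y\<close> lies in it with probability at least about \<open>1/(m d)\<close>, whatever \<open>c\<close> is, while
  \<open>x\<^sub>1, \<dots>, x\<^sub>k\<close> all lie in \<open>\<Gamma>\<close> with probability at least about \<open>1/m\<^sup>k\<close>.\<close>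

section \<open>Countability of generated subgroups\<close>

text \<open>Each element is the value of a word in \<open>S\<close> and its inverses, and there are
  countably many words. For finitely generated \<open>G\<close> this makes the event in
  \<open>dc\<close> measurable.\<close>

lemma (in group) countable_generate:
  assumes "countable S" "S \<subseteq> carrier G"
  shows "countable (generate G S)"
proof -
  let ?p = "\<lambda>l. foldr (\<otimes>) l \<one>"
  let ?A = "S \<union> (\<lambda>x. inv x) ` S"
  have A: "?A \<subseteq> carrier G" using assms(2) by auto
  have closed: "?p l \<in> carrier G" if "l \<in> lists ?A" for l
    using that A by (induction l) auto
  have app: "?p (l @ l') = ?p l \<otimes> ?p l'" if "l \<in> lists ?A" "l' \<in> lists ?A" for l l'
    using that(1)
  proof (induction l)
    case (Cons a l)
    then show ?case using closed[OF that(2)] closed[of l] A by (auto simp: m_assoc)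
  qed (use closed[OF that(2)] in simp)
  have "x \<in> ?p ` lists ?A" if "x \<in> generate G S" for x
    using that
  proof induction
    case one
    then show ?case by (auto intro: rev_image_eqI[of "[]"])
  next
    case (incl h)
    then show ?case using assms(2) by (auto intro!: rev_image_eqI[of "[h]"])
  next
    case (inv h)
    then show ?case using assms(2) by (auto intro!: rev_image_eqI[of "[inv h]"])
  next
    case (eng g h)
    then obtain l l' where "l \<in> lists ?A" "l' \<in> lists ?A" "g = ?p l" "h = ?p l'" by blast
    then show ?case using app by (intro rev_image_eqI[of "l @ l'"]) auto
  qed
  then have "generate G S \<subseteq> ?p ` lists ?A" by blast
  moreover have "countable (?p ` lists ?A)" using assms(1) by simp
  ultimately show ?thesis by (rule countable_subset)
qed

section \<open>Simple commutators, subgroups and quotients\<close>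

lemma (in group) group_commutator_closed [simp]:
  "x \<in> carrier G \<Longrightarrow> y \<in> carrier G \<Longrightarrow> group_commutator G x y \<in> carrier G"
  by (simp add: group_commutator_def)

lemma (in group) simple_commutator_closed:
  "x \<in> {..k} \<rightarrow> carrier G \<Longrightarrow> simple_commutator G x k \<in> carrier G"
  by (induction k) (auto simp: Pi_iff)

text \<open>Serves both for the inclusion of a subgroup and for a quotient map.\<close>

lemma (in group_hom) hom_simple_commutator:
  "x \<in> {..k} \<rightarrow> carrier G \<Longrightarrow>
     h (simple_commutator G x k) = simple_commutator H (\<lambda>i. h (x i)) k"
proof (induction k)
  case (Suc k)
  then have "x \<in> {..k} \<rightarrow> carrier G" "x (Suc k) \<in> carrier G" by auto
  then show ?case using Suc.IH G.simple_commutator_closed[of x k]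
    by (simp add: group_commutator_def)
qed simp

lemma simple_commutator_cong:
  "(\<And>i. i \<le> k \<Longrightarrow> x i = y i) \<Longrightarrow> simple_commutator G x k = simple_commutator G y k"
  by (induction k) auto

lemma (in group) simple_commutator_subgroup:
  assumes "subgroup \<Gamma> G" "x \<in> {..k} \<rightarrow> \<Gamma>"
  shows "simple_commutator (G\<lparr>carrier := \<Gamma>\<rparr>) x k = simple_commutator G x k"
proof -
  interpret g: group "G\<lparr>carrier := \<Gamma>\<rparr>" by (rule subgroup_imp_group[OF assms(1)])
  interpret group_hom "G\<lparr>carrier := \<Gamma>\<rparr>" G "\<lambda>x. x"
    using subgroup.subset[OF assms(1)]
    by unfold_locales (auto simp: hom_def)
  show ?thesis using hom_simple_commutator[of x k] assms(2) by simp
qed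

text \<open>The quotient map sends the commutator to a commutator of cosets, which is trivial by
  nilpotency, and its kernel is \<open>H\<close>.\<close>

lemma (in group) simple_commutator_mem_of_quotient_nilpotent:
  assumes \<Gamma>: "subgroup \<Gamma> G" and H: "H \<lhd> G\<lparr>carrier := \<Gamma>\<rparr>"
    and nil: "step_nilpotent k (G\<lparr>carrier := \<Gamma>\<rparr> Mod H)" and x: "x \<in> {..k} \<rightarrow> \<Gamma>"
  shows "simple_commutator G x k \<in> H"
proof -
  let ?K = "G\<lparr>carrier := \<Gamma>\<rparr>"
  have eq: "simple_commutator ?K x k = simple_commutator G x k"
    by (rule simple_commutator_subgroup[OF \<Gamma> x])
  let ?q = "\<lambda>a. H #>\<^bsub>?K\<^esub> a"
  interpret N: normal H ?K by (rule H)
  interpret group_hom ?K "?K Mod H" ?q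
    by (intro group_hom.intro group_hom_axioms.intro N.is_group N.factorgroup_is_group N.r_coset_hom_Mod)
  have "?q (simple_commutator ?K x k) = simple_commutator (?K Mod H) (\<lambda>i. ?q (x i)) k"
    using x by (intro hom_simple_commutator) auto
  also have "\<dots> = \<one>\<^bsub>?K Mod H\<^esub>"
    using nil x hom_closed unfolding step_nilpotent_def by (auto simp: Pi_iff)
  finally have "?q (simple_commutator ?K x k) = H" by (simp add: FactGroup_def)
  then have "simple_commutator ?K x k \<in> H"
    using N.rcos_self[OF N.simple_commutator_closed, of x k] x N.is_subgroup by auto
  then show ?thesis by (simp add: eq)
qed

section \<open>Subgroups of bounded index that kill the last entry\<close>

lemma (in group) index_le_by_separating_map:
  assumes \<Gamma>: "subgroup \<Gamma> G" "finite_index G \<Gamma>" and C: "subgroup C G"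
    and fin: "finite (f ` \<Gamma>)"
    and sep: "\<And>a b. a \<in> \<Gamma> \<Longrightarrow> b \<in> \<Gamma> \<Longrightarrow> f a = f b \<Longrightarrow> a \<otimes> inv b \<in> C"
  shows "finite_index G C" "group_index G C \<le> group_index G \<Gamma> * card (f ` \<Gamma>)"
proof -
  note [simp] = subgroup.mem_carrier[OF \<Gamma>(1)]
  \<comment> \<open>\<open>t\<close> chooses a representative of a coset of \<Gamma>, and
    \<open>s\<close> a preimage in \<Gamma> of a value of \<open>f\<close>.\<close>
  define t where "t = (\<lambda>R. SOME g. g \<in> carrier G \<and> R = \<Gamma> #> g)"
  define s where "s = (\<lambda>y. SOME g. g \<in> \<Gamma> \<and> f g = y)"
  let ?P = "f ` \<Gamma> \<times> rcosets \<Gamma>"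
  let ?F = "\<lambda>(y, R). C #> (s y \<otimes> t R)"
  have "rcosets C \<subseteq> ?F ` ?P"
  proof
    fix R assume "R \<in> rcosets C"
    then obtain g where g: "g \<in> carrier G" "R = C #> g" by (auto simp: RCOSETS_def)
    define T where "T = \<Gamma> #> g"
    have T: "T \<in> rcosets \<Gamma>" using g by (auto simp: T_def RCOSETS_def)
    have t: "t T \<in> carrier G" "T = \<Gamma> #> t T"
      unfolding t_def using someI[of "\<lambda>a. a \<in> carrier G \<and> T = \<Gamma> #> a" g] g T_def by auto
    have "g \<in> \<Gamma> #> t T"
      using rcos_self[OF g(1) \<Gamma>(1)] t(2) T_def by simp
    then obtain a where a: "a \<in> \<Gamma>" "g = a \<otimes> t T" by (auto simp: r_coset_def)
    have s: "s (f a) \<in> \<Gamma>" "f (s (f a)) = f a"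
      unfolding s_def using someI[of "\<lambda>b. b \<in> \<Gamma> \<and> f b = f a" a] a by auto
    have "a \<otimes> inv (s (f a)) \<in> C" using sep[of a "s (f a)"] a s by simp
    then have "a \<in> C #> s (f a)"
      unfolding r_coset_def using a s by (auto intro!: bexI[of _ "a \<otimes> inv (s (f a))"] simp: m_assoc)
    then have "C #> a = C #> s (f a)"
      using repr_independence[of a C "s (f a)"] C s by simp
    then have "R = C #> (s (f a) \<otimes> t T)"
      using a g s t(1) subgroup.subset[OF C] by (simp flip: coset_mult_assoc)
    then show "R \<in> ?F ` ?P" using a T by (auto intro!: rev_image_eqI[of "(f a, T)"])
  qed
  moreover have "finite ?P" using fin \<Gamma>(2) by (simp add: finite_index_def)
  ultimately show "finite_index G C" "group_index G C \<le> group_index G \<Gamma> * card (f ` \<Gamma>)"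
    unfolding finite_index_def group_index_def
    using finite_surj surj_card_le[of ?P "rcosets C" ?F]
    by (auto simp: card_cartesian_product mult.commute)
qed

lemma (in group) subgroup_centralizer:
  assumes "subgroup \<Gamma> G" "c \<in> carrier G"
  shows "subgroup {g \<in> \<Gamma>. c \<otimes> g = g \<otimes> c} G"
proof (rule subgroupI)
  note [simp] = subgroup.mem_carrier[OF assms(1)] assms(2)
  show "{g \<in> \<Gamma>. c \<otimes> g = g \<otimes> c} \<subseteq> carrier G" by auto
  show "{g \<in> \<Gamma>. c \<otimes> g = g \<otimes> c} \<noteq> {}"
    using subgroup.one_closed[OF assms(1)] by force
  fix a assume a: "a \<in> {g \<in> \<Gamma>. c \<otimes> g = g \<otimes> c}"
  then have "a \<in> carrier G" by simp
  have "c \<otimes> inv a = inv a \<otimes> (a \<otimes> c) \<otimes> inv a"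
    using a by (simp flip: m_assoc)
  also have "\<dots> = inv a \<otimes> (c \<otimes> a) \<otimes> inv a" using a by simp
  also have "\<dots> = inv a \<otimes> c" using \<open>a \<in> carrier G\<close> by (simp add: m_assoc)
  finally show "inv a \<in> {g \<in> \<Gamma>. c \<otimes> g = g \<otimes> c}"
    using a subgroup.m_inv_closed[OF assms(1)] by simp
  fix b assume b: "b \<in> {g \<in> \<Gamma>. c \<otimes> g = g \<otimes> c}"
  then have "c \<otimes> (a \<otimes> b) = a \<otimes> b \<otimes> c"
    using a assms(2) subgroup.mem_carrier[OF assms(1)] by (metis (mono_tags, lifting) m_assoc mem_Collect_eq)
  then show "a \<otimes> b \<in> {g \<in> \<Gamma>. c \<otimes> g = g \<otimes> c}"
    using a b subgroup.m_closed[OF assms(1)] by simp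
qed

text \<open>\<open>C\<close> may vary with \<open>x\<close>, but the bound on its index does not;
  this allows one estimate for all choices of the first \<open>k\<close> entries.\<close>

lemma (in group) exists_small_index_subgroup_annihilating:
  assumes \<Gamma>: "subgroup \<Gamma> G" "finite_index G \<Gamma>"
    and H: "H \<lhd> G\<lparr>carrier := \<Gamma>\<rparr>" "finite H"
    and nil: "step_nilpotent k (G\<lparr>carrier := \<Gamma>\<rparr> Mod H)"
    and x: "x \<in> {..<k} \<rightarrow> \<Gamma>"
  shows "\<exists>C. subgroup C G \<and> finite_index G C \<and> group_index G C \<le> group_index G \<Gamma> * card H
           \<and> (\<forall>y\<in>C. simple_commutator G (x(k := y)) k = \<one>)"
proof -
  note [simp] = subgroup.mem_carrier[OF \<Gamma>(1)]
  have in_H: "simple_commutator G (x(k := y)) k \<in> H" if "y \<in> \<Gamma>" for y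
    using that x by (intro simple_commutator_mem_of_quotient_nilpotent[OF \<Gamma>(1) H(1) nil]) (auto simp: Pi_iff)
  \<comment> \<open>Common end of both cases: a map with values in an image of \<open>H\<close>
    takes at most \<open>card H\<close> values.\<close>
  have bound: ?thesis if C: "subgroup C G" and f: "f ` \<Gamma> \<subseteq> g ` H"
      and sep: "\<And>a b. a \<in> \<Gamma> \<Longrightarrow> b \<in> \<Gamma> \<Longrightarrow> f a = f b \<Longrightarrow> a \<otimes> inv b \<in> C"
      and kill: "\<And>y. y \<in> C \<Longrightarrow> simple_commutator G (x(k := y)) k = \<one>" for C and f g :: "'a \<Rightarrow> 'a"
  proof -
    have fin: "finite (f ` \<Gamma>)" using finite_subset[OF f] H(2) by blast
    have "card (f ` \<Gamma>) \<le> card H" using surj_card_le[OF H(2) f] .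
    then have le: "group_index G \<Gamma> * card (f ` \<Gamma>) \<le> group_index G \<Gamma> * card H" by simp
    have "finite_index G C" "group_index G C \<le> group_index G \<Gamma> * card (f ` \<Gamma>)"
      by (rule index_le_by_separating_map[OF \<Gamma> C fin]; rule sep; assumption)+
    then show ?thesis using le C kill le_trans by blast
  qed
  show ?thesis
  proof (cases k)
    case 0
    \<comment> \<open>The 1-fold commutator is \<open>y\<close> itself, so \<Gamma> lies in
      \<open>H\<close>, and the trivial subgroup already has small enough index.\<close>
    then have "\<Gamma> \<subseteq> H" using in_H by auto
    then show ?thesis
      using 0 by (intro bound[of "{\<one>}" id id] triv_subgroup) auto
  next
    case (Suc j)
    define c where "c = simple_commutator G x j"
    have sc: "simple_commutator G (x(k := y)) k = group_commutator G c y" for y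
      using Suc simple_commutator_cong[of j "x(k := y)" x G] by (simp add: c_def)
    have c: "c \<in> carrier G"
      unfolding c_def using x Suc by (intro simple_commutator_closed) (auto simp: Pi_iff)
    \<comment> \<open>Conjugating \<open>c\<close> by \<open>a\<close> multiplies it on the right by
      a commutator in \<open>H\<close>; hence \<open>c\<close> has at most \<open>card H\<close>
      conjugates under \<Gamma>.\<close>
    have conj: "inv a \<otimes> c \<otimes> a = c \<otimes> group_commutator G c a" if "a \<in> \<Gamma>" for a
      using that c by (simp add: group_commutator_def flip: m_assoc)
    show ?thesis
    proof (rule bound[OF subgroup_centralizer[OF \<Gamma>(1) c], of "\<lambda>a. inv a \<otimes> c \<otimes> a" "\<lambda>h. c \<otimes> h"])
      show "(\<lambda>a. inv a \<otimes> c \<otimes> a) ` \<Gamma> \<subseteq> (\<lambda>h. c \<otimes> h) ` H"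
        using in_H conj sc by auto
      show "simple_commutator G (x(k := y)) k = \<one>" if "y \<in> {g \<in> \<Gamma>. c \<otimes> g = g \<otimes> c}" for y
      proof -
        have y: "y \<in> carrier G" "c \<otimes> y = y \<otimes> c" using that by auto
        have "group_commutator G c y = inv c \<otimes> inv y \<otimes> (c \<otimes> y)"
          using c y(1) by (simp add: group_commutator_def m_assoc)
        also have "\<dots> = inv (y \<otimes> c) \<otimes> (y \<otimes> c)"
          unfolding y(2) using c y(1) by (simp add: inv_mult_group)
        also have "\<dots> = \<one>" using c y(1) by (intro l_inv) simp
        finally show ?thesis unfolding sc .
      qed
      fix a b assume ab: "a \<in> \<Gamma>" "b \<in> \<Gamma>" and eq: "inv a \<otimes> c \<otimes> a = inv b \<otimes> c \<otimes> b"
      \<comment> \<open>Equal conjugates of \<open>c\<close> force \<open>a \<otimes> inv b\<close>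
        to centralise \<open>c\<close>, so conjugation is a separating map.\<close>
      have "c \<otimes> (a \<otimes> inv b) = a \<otimes> (inv a \<otimes> c \<otimes> a) \<otimes> inv b"
        using ab c by (simp flip: m_assoc)
      also have "\<dots> = a \<otimes> inv b \<otimes> c"
        using ab c unfolding eq by (simp add: m_assoc)
      finally show "a \<otimes> inv b \<in> {g \<in> \<Gamma>. c \<otimes> g = g \<otimes> c}"
        using ab subgroup.m_closed[OF \<Gamma>(1)] subgroup.m_inv_closed[OF \<Gamma>(1)] by simp
    qed
  qed
qed

section \<open>Probability estimates\<close>

text \<open>Tonelli: the last entry is integrated first. The inner integral is at least
  \<open>p\<close> when the first \<open>k\<close> entries lie in \<Gamma>, and is bounded below by
  0 elsewhere.\<close>

lemma dc_ge:
  assumes \<mu>: "prob_measure_on G \<mu>" and cnt: "countable (carrier G)"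
    and \<Gamma>: "\<Gamma> \<subseteq> carrier G"
    and p: "0 \<le> p" "\<And>x. x \<in> {..<k} \<rightarrow> \<Gamma> \<Longrightarrow>
              p \<le> measure \<mu> {y \<in> carrier G. simple_commutator G (x(k := y)) k = \<one>\<^bsub>G\<^esub>}"
  shows "p * measure \<mu> \<Gamma> ^ k \<le> dc k G \<mu>"
proof -
  interpret prob_space \<mu> using \<mu> by (simp add: prob_measure_on_def)
  have sp: "space \<mu> = carrier G" and st: "sets \<mu> = Pow (carrier G)"
    using \<mu> by (auto simp: prob_measure_on_def)
  interpret P: product_prob_space "\<lambda>_::nat. \<mu>" UNIV by unfold_locales
  have ins: "{..k} = insert k {..<k}" by auto
  define E where "E = {x \<in> space (\<Pi>\<^sub>M i\<in>{..k}. \<mu>). simple_commutator G x k = \<one>\<^bsub>G\<^esub>}"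
  have E: "E \<in> sets (\<Pi>\<^sub>M i\<in>{..k}. \<mu>)"
    unfolding E_def by (rule dc_event_measurable[OF \<mu> cnt])
  interpret Q: prob_space "\<Pi>\<^sub>M i\<in>{..k}. \<mu>" by (intro prob_space_PiM) unfold_locales
  let ?R = "{..<k} \<rightarrow>\<^sub>E \<Gamma>"
  have R: "?R \<in> sets (\<Pi>\<^sub>M i\<in>{..<k}. \<mu>)"
    using \<Gamma> by (intro sets_PiM_I_finite) (auto simp: st)
  have "ennreal (p * measure \<mu> \<Gamma> ^ k) = ennreal p * emeasure (\<Pi>\<^sub>M i\<in>{..<k}. \<mu>) ?R"
    using \<Gamma> p(1) by (subst P.emeasure_PiM) (auto simp: st emeasure_eq_measure ennreal_mult ennreal_power)
  also have "\<dots> = (\<integral>\<^sup>+x. ennreal p * indicator ?R x \<partial>(\<Pi>\<^sub>M i\<in>{..<k}. \<mu>))"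
    using R by (simp add: nn_integral_cmult_indicator)
  also have "\<dots> \<le> (\<integral>\<^sup>+x. (\<integral>\<^sup>+y. indicator E (x(k := y)) \<partial>\<mu>) \<partial>(\<Pi>\<^sub>M i\<in>{..<k}. \<mu>))"
  proof (rule nn_integral_mono)
    fix x assume x: "x \<in> space (\<Pi>\<^sub>M i\<in>{..<k}. \<mu>)"
    let ?Y = "{y \<in> carrier G. simple_commutator G (x(k := y)) k = \<one>\<^bsub>G\<^esub>}"
    \<comment> \<open>\<open>x\<close> is \<open>undefined\<close> outside \<open>{..<k}\<close>, so
      \<open>x(k := y)\<close> is extensional on \<open>{..k}\<close> and the section of
      \<open>E\<close> at \<open>x\<close> is exactly \<open>?Y\<close>.\<close>
    have "(\<integral>\<^sup>+y. indicator E (x(k := y)) \<partial>\<mu>) = (\<integral>\<^sup>+y. indicator ?Y y \<partial>\<mu>)"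
      using x by (intro nn_integral_cong)
        (auto simp: E_def indicator_def space_PiM sp PiE_iff extensional_def)
    also have "\<dots> = ennreal (measure \<mu> ?Y)"
      by (subst nn_integral_indicator) (auto simp: st emeasure_eq_measure)
    finally show "ennreal p * indicator ?R x \<le> (\<integral>\<^sup>+y. indicator E (x(k := y)) \<partial>\<mu>)"
      using p(2)[of x] by (auto simp: indicator_def PiE_iff Pi_iff intro!: ennreal_leI)
  qed
  also have "\<dots> = (\<integral>\<^sup>+x. indicator E x \<partial>(\<Pi>\<^sub>M i\<in>{..k}. \<mu>))"
    unfolding ins using E unfolding ins by (subst P.product_nn_integral_insert) auto
  also have "\<dots> = ennreal (dc k G \<mu>)"
    using E by (simp add: dc_def E_def[symmetric] Q.emeasure_eq_measure)
  finally show ?thesis by (simp add: dc_def)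
qed

lemma (in group) group_index_pos:
  assumes "finite_index G K"
  shows "0 < group_index G K"
  using assms unfolding finite_index_def group_index_def
  by (auto simp: card_gt_0_iff RCOSETS_def)

text \<open>A single threshold for \<open>n\<close> must serve all \<open>K\<close>, since the
  centralisers to which it is applied vary with the random entries. This is where uniformity
  enters.\<close>

lemma measure_small_index_subgroups:
  assumes "group G" "measures_index_uniformly G M" "0 < e"
  shows "\<forall>\<^sub>F n in sequentially. \<forall>K. subgroup K G \<and> finite_index G K \<and> group_index G K \<le> N \<longrightarrow>
           1 / real N - e \<le> measure (M n) K"
proof -
  interpret group G by fact
  have "\<forall>\<^sub>F n in sequentially. \<forall>xK\<in>{(x, H). x \<in> carrier G \<and> subgroup H G}.
      dist ((\<lambda>(x, H). measure (M n) (x <#\<^bsub>G\<^esub> H)) xK)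
        ((\<lambda>(x, H). if finite_index G H then 1 / real (group_index G H) else 0) xK) < e"
    using assms(2,3) unfolding measures_index_uniformly_def by (rule uniform_limitD)
  then show ?thesis
  proof (rule eventually_mono, intro allI impI, elim conjE)
    fix n K
    assume *: "\<forall>xK\<in>{(x, H). x \<in> carrier G \<and> subgroup H G}.
      dist ((\<lambda>(x, H). measure (M n) (x <#\<^bsub>G\<^esub> H)) xK)
        ((\<lambda>(x, H). if finite_index G H then 1 / real (group_index G H) else 0) xK) < e"
      and K: "subgroup K G" "finite_index G K" "group_index G K \<le> N"
    have "\<one>\<^bsub>G\<^esub> <#\<^bsub>G\<^esub> K = K" using lcos_mult_one subgroup.subset[OF K(1)] by simp
    then have "dist (measure (M n) K) (1 / real (group_index G K)) < e"
      using bspec[OF *, of "(\<one>\<^bsub>G\<^esub>, K)"] K by simp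
    moreover have "1 / real N \<le> 1 / real (group_index G K)"
      using K(3) group_index_pos[OF K(2)] by (intro divide_left_mono) auto
    ultimately show "1 / real N - e \<le> measure (M n) K" by (simp add: dist_real_def abs_if split: if_splits)
  qed
qed

theorem proposition1p9:
  fixes G :: "('a, 'b) monoid_scheme"
    and \<Gamma> H :: "'a set"
    and M :: "nat \<Rightarrow> 'a measure"
    and m d k :: nat
  assumes "finitely_generated_group G"
    and "subgroup \<Gamma> G" and "finite_index G \<Gamma>" and "group_index G \<Gamma> \<le> m"
    and "H \<lhd> G\<lparr>carrier := \<Gamma>\<rparr>" and "finite H" and "card H \<le> d"
    and "step_nilpotent k (G\<lparr>carrier := \<Gamma>\<rparr> Mod H)"
    and "\<And>n. prob_measure_on G (M n)"
    and "measures_index_uniformly G M"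
  shows "dc_limsup k G M \<ge> ereal (1 / (real m ^ (k + 1) * real d))"
proof -
  interpret group G using assms(1) by (simp add: finitely_generated_group_def)
  have cnt: "countable (carrier G)"
    using assms(1) countable_generate countable_finite unfolding finitely_generated_group_def by metis
  have m: "0 < m" using group_index_pos[OF assms(3)] assms(4) by simp
  have "H \<noteq> {}" using normal_imp_subgroup[OF assms(5)] subgroup.one_closed by fastforce
  then have d: "0 < d" using assms(6,7) card_gt_0_iff[of H] by simp
  \<comment> \<open>The first factor is the bound for the last entry, the power that for the other
    \<open>k\<close> entries lying in \<Gamma>; \<open>e\<close> is the error in the
    measures.\<close>
  define b where "b = (\<lambda>e. (1 / real (m * d) - e) * (1 / real m - e) ^ k)"
  have "ereal (b e) \<le> dc_limsup k G M" if e: "0 < e" "e < 1 / real (m * d)" for e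
  proof -
    \<comment> \<open>Both factors of \<open>b e\<close> must be nonnegative for the monotonicity of
      products and powers.\<close>
    have "1 / real (m * d) \<le> 1 / real m"
      using m d by (intro divide_left_mono) auto
    then have e': "e < 1 / real m" using e by simp
    have "\<forall>\<^sub>F n in sequentially. b e \<le> dc k G (M n)"
      using measure_small_index_subgroups[OF is_group assms(10) e(1), of "m * d"]
        measure_small_index_subgroups[OF is_group assms(10) e(1), of m]
    proof eventually_elim
      case (elim n)
      interpret prob_space "M n" using assms(9)[of n] by (simp add: prob_measure_on_def)
      have st: "sets (M n) = Pow (carrier G)" using assms(9)[of n] by (simp add: prob_measure_on_def)
      have "1 / real (m * d) - e \<le> measure (M n) {y \<in> carrier G. simple_commutator G (x(k := y)) k = \<one>\<^bsub>G\<^esub>}"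
        if x: "x \<in> {..<k} \<rightarrow> \<Gamma>" for x
      proof -
        obtain C where C: "subgroup C G" "finite_index G C"
            "group_index G C \<le> group_index G \<Gamma> * card H"
            "\<forall>y\<in>C. simple_commutator G (x(k := y)) k = \<one>\<^bsub>G\<^esub>"
          using exists_small_index_subgroup_annihilating[OF assms(2,3,5,6,8) x] by blast
        have "group_index G C \<le> m * d" using C(3) mult_le_mono[OF assms(4,7)] by simp
        then have "1 / real (m * d) - e \<le> measure (M n) C" using elim(1) C by blast
        also have "\<dots> \<le> measure (M n) {y \<in> carrier G. simple_commutator G (x(k := y)) k = \<one>\<^bsub>G\<^esub>}"
          using C(4) subgroup.subset[OF C(1)] by (intro finite_measure_mono) (auto simp: st)
        finally show ?thesis .
      qed
      then have "(1 / real (m * d) - e) * measure (M n) \<Gamma> ^ k \<le> dc k G (M n)"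
        using e by (intro dc_ge[OF assms(9) cnt subgroup.subset[OF assms(2)]]) auto
      moreover have "b e \<le> (1 / real (m * d) - e) * measure (M n) \<Gamma> ^ k"
        unfolding b_def using e e' elim(2) assms(2-4) by (intro mult_left_mono power_mono) auto
      ultimately show ?case by simp
    qed
    \<comment> \<open>The bound holds for all large \<open>n\<close>, so it bounds even the lower
      limit.\<close>
    then have "ereal (b e) \<le> liminf (\<lambda>n. ereal (dc k G (M n)))"
      by (intro Liminf_bounded) (auto elim: eventually_mono)
    also have "\<dots> \<le> dc_limsup k G M"
      unfolding dc_limsup_def by (intro Liminf_le_Limsup) simp
    finally show ?thesis .
  qed
  \<comment> \<open>Now \<open>e\<close> tends to 0 from the right; \<open>b\<close> is continuous
    and \<open>b 0\<close> is the claimed constant.\<close>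
  then have "\<forall>\<^sub>F e in at_right 0. ereal (b e) \<le> dc_limsup k G M"
    using m d unfolding eventually_at_right_field by (intro exI[of _ "1 / real (m * d)"]) auto
  moreover have "((\<lambda>e. ereal (b e)) \<longlongrightarrow> ereal (b 0)) (at_right 0)"
    unfolding b_def by (intro tendsto_intros)
  ultimately have "ereal (b 0) \<le> dc_limsup k G M"
    by (intro tendsto_upperbound) auto
  moreover have "b 0 = 1 / (real m ^ (k + 1) * real d)"
    by (simp add: b_def power_divide)
  ultimately show ?thesis by simp
qed

end
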